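(* Let $N$ be an even positive integer and let $u_0:\{1,\ldots,N\}\to\{0,1\}$ be a binary signal, regarded as periodic (so that $N$ and $1$ are adjacent). Suppose that $u_0$ consists of exactly $2d$ consecutive intervals of ones and zeros, $d\ge 1$, i.e. $u_0=\sum_{j=1}^{2d}\xi_j\mathbf{1}_{I_j}$, where $I_1,\ldots,I_{2d}$ is a partition of $\{1,\ldots,N\}$ into nonempty cyclically consecutive intervals (listed in cyclic order), $\xi_j\in\{0,1\}$, and cyclically adjacent intervals carry different values. For $u:\{1,\ldots,N\}\to\mathbb{R}$ write $a_k(u)=\sum_{x=1}^N u(x)e^{-2\pi i kx/N}$. Then $u_0$ is the unique $u:\{1,\ldots,N\}\to\mathbb{R}$ satisfying $$a_k(u)=a_k(u_0)\ \text{ for all integers } k \text{ with } |k|\le d,\qquad 0\le u(x)\le 1\ \text{ for all } x.$$ This is optimal: for every integer $m$ with $0\le m<d$, $u_0$ is not the unique $u:\{1,\ldots,N\}\to\mathbb{R}$ satisfying $a_k(u)=a_k(u_0)$ for all $|k|\le m$ and $0\le u\le 1$.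
   Context: Frequencies are indexed modulo $N$ by $k\in\{-N/2,\ldots,N/2-1\}$, with $N/2$ identified with $-N/2$. If the first and last constant runs of $u_0$ on $\{1,\ldots,N\}$ have the same value, they are merged into one interval under the periodic boundary condition; hence the number of intervals of a non-constant signal is always even. *)

theory Defs
  imports Complex_Main "HOL-Library.FuncSet" "HOL-Library.Disjoint_Sets"
    "HOL-Library.Indicator_Function"
begin

text \<open>
  A signal on \<open>{1..N}\<close> is an element of \<open>{1..N} \<rightarrow>\<^sub>E UNIV\<close>, so that equality of signals is
  pointwise equality on \<open>{1..N}\<close>.
\<close>

definition fourier_coeff :: "nat \<Rightarrow> (nat \<Rightarrow> real) \<Rightarrow> int \<Rightarrow> complex" where
  "fourier_coeff N u k =
     (\<Sum>x = 1..N. of_real (u x) * exp (- 2 * of_real pi * \<i> * of_int k * of_nat x / of_nat N))"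

text \<open>On \<open>{1..n}\<close>, \<open>cyc_succ n\<close> is the successor modulo \<open>n\<close>; in particular it maps \<open>n\<close> to \<open>1\<close>.\<close>

definition cyc_succ :: "nat \<Rightarrow> nat \<Rightarrow> nat" where
  "cyc_succ n x = x mod n + 1"

definition cyc_interval :: "nat \<Rightarrow> nat \<Rightarrow> nat \<Rightarrow> nat set" where
  "cyc_interval N s l = (\<lambda>i. (cyc_succ N ^^ i) s) ` {..<l}"

text \<open>
  The last conjunct expresses the cyclic order: every interval starts at the point following the
  end of its predecessor.
\<close>

definition cyc_interval_partition :: "nat \<Rightarrow> nat \<Rightarrow> (nat \<Rightarrow> nat set) \<Rightarrow> bool" where
  "cyc_interval_partition N n I \<longleftrightarrow>
     disjoint_family_on I {1..n} \<and> (\<Union>j\<in>{1..n}. I j) = {1..N} \<and>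
     (\<exists>s l. \<forall>j\<in>{1..n}.
        s j \<in> {1..N} \<and> l j \<in> {1..N} \<and> I j = cyc_interval N (s j) (l j) \<and>
        s (cyc_succ n j) = (cyc_succ N ^^ l j) (s j))"

definition consists_of_intervals :: "nat \<Rightarrow> nat \<Rightarrow> (nat \<Rightarrow> real) \<Rightarrow> bool" where
  "consists_of_intervals N n u \<longleftrightarrow>
     (\<exists>I \<xi>. cyc_interval_partition N n I \<and>
        (\<forall>j\<in>{1..n}. \<xi> j \<in> {0, 1 :: real}) \<and>
        (\<forall>j\<in>{1..n}. \<xi> j \<noteq> \<xi> (cyc_succ n j)) \<and>
        (\<forall>x\<in>{1..N}. u x = (\<Sum>j = 1..n. \<xi> j * indicator (I j) x)))"

definition feasible :: "nat \<Rightarrow> nat \<Rightarrow> (nat \<Rightarrow> real) \<Rightarrow> (nat \<Rightarrow> real) set" where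
  "feasible N m u\<^sub>0 = {u \<in> {1..N} \<rightarrow>\<^sub>E UNIV.
     (\<forall>k::int. \<bar>k\<bar> \<le> int m \<longrightarrow> fourier_coeff N u k = fourier_coeff N u\<^sub>0 k) \<and>
     (\<forall>x\<in>{1..N}. 0 \<le> u x \<and> u x \<le> 1)}"

end

(* Put a jump s at each start of an interval. The product over the 2d jumps of
   sin (pi (x - s + 1/2) / N) is a trigonometric polynomial of degree d whose sign on {1..N} is,
   up to a global sign, that of 1 - 2 u0. For a feasible u the difference u - u0 has this sign
   pattern too, but is orthogonal to the product, so it vanishes.
   For optimality, perturb u0 only at the jumps, by multiples of
   1 / prod_{t \<noteq> s} sin (pi (s - t) / N). This is a divided difference functional on the points
   exp (-2 pi i s / N), hence kills all frequencies of modulus < d, and its sign pattern is again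
   that of 1 - 2 u0, so a small multiple keeps the values in [0,1]. *)

theory Submission
  imports Defs "HOL-Computational_Algebra.Polynomial"
begin

section \<open>Polynomial identities behind products of sines\<close>

text \<open>This is the leading coefficient of the Lagrange interpolation polynomial of a monomial of
  degree less than \<open>card S - 1\<close>, up to sign.\<close>

lemma sum_power_divided_by_node_differences_eq_0:
  fixes z :: "'a \<Rightarrow> 'b :: field"
  assumes fin: "finite S" and inj: "inj_on z S" and k: "k + 1 < card S"
  shows "(\<Sum>s\<in>S. z s ^ k / (\<Prod>t\<in>S-{s}. z t - z s)) = 0"
proof -
  define n where "n = card S - 1"
  define B where "B s = (\<Prod>t\<in>S-{s}. [:z t, -1:])" for s
  define w where "w s = z s ^ k / (\<Prod>t\<in>S-{s}. z t - z s)" for s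
  have deg_B: "degree (B s) = n" if "s \<in> S" for s
    using that fin by (simp add: B_def n_def degree_prod_sum_eq)
  have coeff_B: "coeff (B s) n = (-1) ^ n" if "s \<in> S" for s
  proof -
    have "lead_coeff (B s) = (-1) ^ n"
      using that fin by (simp add: B_def lead_coeff_prod n_def)
    then show ?thesis using deg_B[OF that] by simp
  qed
  have B_other: "poly (B s) (z t) = 0" if "t \<in> S" "s \<noteq> t" for s t
    using that fin by (auto simp: B_def poly_prod prod_zero_iff)
  have B_self: "poly (B s) (z s) = (\<Prod>t\<in>S-{s}. z t - z s)" for s
    by (simp add: B_def poly_prod)
  have B_self_nz: "(\<Prod>t\<in>S-{s}. z t - z s) \<noteq> 0" if "s \<in> S" for s
    using that fin inj by (auto simp: inj_on_def)
  define P where "P = (\<Sum>s\<in>S. smult (w s) (B s))"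
  \<comment> \<open>\<open>P\<close> interpolates the k-th power at \<open>card S\<close> distinct
    points. Both polynomials have degree less than \<open>card S\<close>, so they coincide, and
    since k < n the coefficient of \<open>P\<close> at \<open>n\<close> vanishes.\<close>
  have P_eq: "P = monom 1 k"
  proof (rule poly_eqI_degree)
    show "poly P x = poly (monom 1 k) x" if "x \<in> z ` S" for x
    proof -
      from that obtain t where t: "t \<in> S" "x = z t" by blast
      have "poly P x = (\<Sum>s\<in>S. w s * poly (B s) (z t))"
        by (simp add: P_def poly_sum t)
      also have "\<dots> = (\<Sum>s\<in>S. if s = t then w s * poly (B s) (z t) else 0)"
        by (rule sum.cong) (auto simp: B_other t)
      also have "\<dots> = w t * poly (B t) (z t)"
        using fin t by simp
      also have "\<dots> = z t ^ k"
        using B_self_nz[OF t(1)] by (simp add: w_def B_self)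
      finally show ?thesis by (simp add: t poly_monom)
    qed
    have card: "card (z ` S) = card S" by (rule card_image[OF inj])
    have "degree P \<le> n"
      unfolding P_def
      by (rule degree_sum_le[OF fin]) (metis deg_B degree_smult_le)
    then show "card (z ` S) > degree P" using k by (simp add: n_def card)
    show "card (z ` S) > degree (monom (1::'b) k)"
      using k by (simp add: card degree_monom_eq)
  qed
  have "coeff P n = (\<Sum>s\<in>S. w s * (-1) ^ n)"
    unfolding P_def coeff_sum by (rule sum.cong) (auto simp: coeff_B)
  also have "\<dots> = (\<Sum>s\<in>S. w s) * (-1) ^ n"
    by (simp add: sum_distrib_right)
  finally have "(\<Sum>s\<in>S. w s) * (-1) ^ n = coeff P n" ..
  also have "coeff P n = 0"
    using k by (simp add: P_eq n_def)
  finally show ?thesis by (simp add: w_def)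
qed

text \<open>Up to phases and the constant \<open>2 * \<i>\<close>, the sine of a difference is a
  difference of points on the unit circle. This turns products of sines into polynomials in
  \<open>cis (-2 * a)\<close>.\<close>

lemma of_real_sin_diff_eq_cis:
  "complex_of_real (sin (a - b)) = cis a * cis b * (cis (-2 * b) - cis (-2 * a)) / (2 * \<i>)"
proof -
  have "cis (a - b) - cis (b - a) = 2 * \<i> * of_real (sin (a - b))"
    by (simp add: complex_eq_iff sin_diff cos_diff)
  then have "complex_of_real (sin (a - b)) = (cis (a - b) - cis (b - a)) / (2 * \<i>)"
    by simp
  moreover have "cis a * cis b * (cis (-2 * b) - cis (-2 * a)) = cis (a - b) - cis (b - a)"
    by (simp add: algebra_simps cis_mult)
  ultimately show ?thesis by (simp only:)
qed

text \<open>A product of 2d sines is a phase times a polynomial of degree 2d in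
  \<open>cis (-2 * \<theta> x)\<close>. The phase \<open>cis (\<theta> x) ^ (2 * d)\<close>
  recentres the exponents 0..2d to the frequencies -d..d, which are the ones covered by
  \<open>moments\<close>.\<close>

lemma sum_times_sin_prod_eq_0:
  fixes h \<theta> :: "'a \<Rightarrow> real" and b :: "'b \<Rightarrow> real"
  assumes fin: "finite S" and card: "card S = 2 * d"
    and moments: "\<And>k::int. \<bar>k\<bar> \<le> int d \<Longrightarrow>
      (\<Sum>x\<in>X. complex_of_real (h x) * cis (-2 * of_int k * \<theta> x)) = 0"
  shows "(\<Sum>x\<in>X. h x * (\<Prod>s\<in>S. sin (\<theta> x - b s))) = 0"
proof -
  \<comment> \<open>\<open>K\<close> gathers the factors that do not depend on \<open>x\<close>;
    \<open>Q\<close> has its roots at the points \<open>cis (-2 * b s)\<close>.\<close>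
  define K where "K = (\<Prod>s\<in>S. cis (b s) / (2 * \<i>))"
  define Q where "Q = (\<Prod>s\<in>S. [:cis (-2 * b s), -1:])"
  have deg_Q: "degree Q = 2 * d"
    using fin by (simp add: Q_def degree_prod_sum_eq card)
  have expand: "complex_of_real (\<Prod>s\<in>S. sin (\<theta> x - b s)) =
      (\<Sum>i\<le>2*d. K * coeff Q i * cis (-2 * of_int (int i - int d) * \<theta> x))" for x
  proof -
    have "complex_of_real (\<Prod>s\<in>S. sin (\<theta> x - b s)) =
        (\<Prod>s\<in>S. cis (b s) / (2 * \<i>) * (cis (\<theta> x) * (cis (-2 * b s) - cis (-2 * \<theta> x))))"
      unfolding of_real_prod of_real_sin_diff_eq_cis by (rule prod.cong) (auto simp: field_simps)
    also have "\<dots> = K * (cis (\<theta> x) ^ (2 * d) * poly Q (cis (-2 * \<theta> x)))"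
      unfolding K_def Q_def poly_prod prod.distrib prod_constant card by simp
    also have "poly Q (cis (-2 * \<theta> x)) = (\<Sum>i\<le>2*d. coeff Q i * cis (-2 * \<theta> x) ^ i)"
      unfolding poly_altdef deg_Q ..
    also have "K * (cis (\<theta> x) ^ (2 * d) * \<dots>) =
        (\<Sum>i\<le>2*d. K * coeff Q i * (cis (\<theta> x) ^ (2 * d) * cis (-2 * \<theta> x) ^ i))"
      by (simp add: sum_distrib_left mult_ac)
    also have "\<dots> = (\<Sum>i\<le>2*d. K * coeff Q i * cis (-2 * of_int (int i - int d) * \<theta> x))"
      by (simp only: DeMoivre cis_mult) (simp add: algebra_simps)
    finally show ?thesis .
  qed
  have "complex_of_real (\<Sum>x\<in>X. h x * (\<Prod>s\<in>S. sin (\<theta> x - b s))) =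
      (\<Sum>x\<in>X. \<Sum>i\<le>2*d. K * coeff Q i *
        (complex_of_real (h x) * cis (-2 * of_int (int i - int d) * \<theta> x)))"
    by (simp only: of_real_sum of_real_mult expand sum_distrib_left mult_ac)
  also have "\<dots> = (\<Sum>i\<le>2*d. K * coeff Q i *
        (\<Sum>x\<in>X. complex_of_real (h x) * cis (-2 * of_int (int i - int d) * \<theta> x)))"
    by (subst sum.swap) (simp only: sum_distrib_left)
  also have "\<dots> = 0"
  proof (rule sum.neutral, rule ballI)
    fix i assume "i \<in> {..2*d}"
    then have "\<bar>int i - int d\<bar> \<le> int d" by auto
    from moments[OF this]
    show "K * coeff Q i *
        (\<Sum>x\<in>X. complex_of_real (h x) * cis (-2 * of_int (int i - int d) * \<theta> x)) = 0"
      by simp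
  qed
  finally show ?thesis by (simp only: of_real_eq_0_iff)
qed

text \<open>Once the phases are cleared, the sum is a constant times a divided difference of a power
  of degree at most 2d - 2 on 2d nodes, which vanishes.\<close>

lemma sum_cis_div_sin_prod_eq_0:
  fixes \<theta> :: "'a \<Rightarrow> real" and k :: int
  assumes fin: "finite S" and card: "card S = 2 * d"
    and sin_nz: "\<And>s t. s \<in> S \<Longrightarrow> t \<in> S \<Longrightarrow> s \<noteq> t \<Longrightarrow> sin (\<theta> s - \<theta> t) \<noteq> 0"
    and k: "\<bar>k\<bar> < int d"
  shows "(\<Sum>s\<in>S. complex_of_real (1 / (\<Prod>t\<in>S-{s}. sin (\<theta> s - \<theta> t))) *
            cis (-2 * of_int k * \<theta> s)) = 0"
proof -
  define z where "z s = cis (-2 * \<theta> s)" for s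
  define C where "C = (\<Prod>t\<in>S. cis (\<theta> t)) / (2 * \<i>) ^ (2 * d - 1)"
  \<comment> \<open>The shift by d - 1 moves the frequencies -(d-1)..d-1 to the exponents
    0..2d-2.\<close>
  define j where "j = nat (k + int d - 1)"
  have j: "int j = k + int d - 1" using k by (simp add: j_def)
  \<comment> \<open>Coinciding nodes would make the sine of the corresponding difference
    vanish.\<close>
  have inj: "inj_on z S"
  proof (rule inj_onI, rule ccontr)
    fix s t assume "s \<in> S" "t \<in> S" "z s = z t" "s \<noteq> t"
    then show False
      using of_real_sin_diff_eq_cis[of "\<theta> s" "\<theta> t"] sin_nz[of s t] by (simp add: z_def)
  qed
  have term_eq: "complex_of_real (1 / (\<Prod>t\<in>S-{s}. sin (\<theta> s - \<theta> t))) * cis (-2 * of_int k * \<theta> s) =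
      1 / C * (z s ^ j / (\<Prod>t\<in>S-{s}. z t - z s))" if s: "s \<in> S" for s
  proof -
    have card': "card (S - {s}) = 2 * d - 1" using s fin card by simp
    have "complex_of_real (\<Prod>t\<in>S-{s}. sin (\<theta> s - \<theta> t)) =
        (\<Prod>t\<in>S-{s}. cis (\<theta> s) / (2 * \<i>) * (cis (\<theta> t) * (z t - z s)))"
      unfolding of_real_prod of_real_sin_diff_eq_cis z_def by (rule prod.cong) (auto simp: field_simps)
    also have "\<dots> = cis (\<theta> s) ^ (2 * d - 1) / (2 * \<i>) ^ (2 * d - 1) *
        ((\<Prod>t\<in>S-{s}. cis (\<theta> t)) * (\<Prod>t\<in>S-{s}. z t - z s))"
      unfolding prod.distrib prod_constant card' power_divide ..
    \<comment> \<open>Completing the product to all of \<open>S\<close> makes the constant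
      \<open>C\<close> independent of \<open>s\<close>, at the price of one more division by
      \<open>cis (\<theta> s)\<close>.\<close>
    also have "(\<Prod>t\<in>S-{s}. cis (\<theta> t)) = (\<Prod>t\<in>S. cis (\<theta> t)) / cis (\<theta> s)"
      using fin s by (simp add: prod_diff1)
    finally have "complex_of_real (\<Prod>t\<in>S-{s}. sin (\<theta> s - \<theta> t)) =
        C * (cis (\<theta> s) ^ (2 * d - 1) / cis (\<theta> s)) * (\<Prod>t\<in>S-{s}. z t - z s)"
      by (simp add: C_def)
    \<comment> \<open>Here \<open>k\<close> forces d to be positive, so \<open>2 * d - 1\<close> is
      a genuine subtraction. The resulting phase also splits off from
      \<open>cis (-2 * of_int k * \<theta> s)\<close>, and the two cancel.\<close>
    moreover have "cis (\<theta> s) ^ (2 * d - 1) / cis (\<theta> s) = cis (2 * (real d - 1) * \<theta> s)"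
      using k by (simp only: DeMoivre cis_divide) (simp add: algebra_simps of_nat_diff)
    moreover have "cis (-2 * of_int k * \<theta> s) = z s ^ j * cis (2 * (real d - 1) * \<theta> s)"
    proof -
      have "real j = of_int k + real d - 1"
        using j by (metis of_int_1 of_int_add of_int_diff of_int_of_nat_eq)
      then show ?thesis
        unfolding z_def by (simp only: DeMoivre cis_mult) (simp add: algebra_simps)
    qed
    moreover have "1 / (C * a * b) * (y * a) = 1 / C * (y / b)" if "a \<noteq> 0" for a b y :: complex
      using that by (simp add: divide_simps)
    ultimately show ?thesis by (simp only: of_real_divide of_real_1 cis_neq_zero not_False_eq_True)
  qed
  have "(\<Sum>s\<in>S. complex_of_real (1 / (\<Prod>t\<in>S-{s}. sin (\<theta> s - \<theta> t))) * cis (-2 * of_int k * \<theta> s)) =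
      1 / C * (\<Sum>s\<in>S. z s ^ j / (\<Prod>t\<in>S-{s}. z t - z s))"
    unfolding sum_distrib_left by (rule sum.cong) (simp_all only: term_eq)
  also have "(\<Sum>s\<in>S. z s ^ j / (\<Prod>t\<in>S-{s}. z t - z s)) = 0"
  proof (rule sum_power_divided_by_node_differences_eq_0[OF fin inj])
    show "j + 1 < card S" using j k card by linarith
  qed
  finally show ?thesis by simp
qed

section \<open>Signs of products with a threshold\<close>

lemma sign_prod_threshold:
  fixes f :: "'a::linorder \<Rightarrow> real"
  assumes "finite S"
    and "\<And>s. s \<in> S \<Longrightarrow> x < s \<Longrightarrow> f s < 0"
    and "\<And>s. s \<in> S \<Longrightarrow> \<not> x < s \<Longrightarrow> 0 < f s"
  shows "0 < (-1) ^ card {s\<in>S. x < s} * (\<Prod>s\<in>S. f s)"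
  using assms
proof (induction S rule: finite_induct)
  case (insert a S)
  have IH: "0 < (-1) ^ card {s\<in>S. x < s} * (\<Prod>s\<in>S. f s)"
    using insert by auto
  show ?case
  proof (cases "x < a")
    case True
    then have "{s\<in>insert a S. x < s} = insert a {s\<in>S. x < s}" by auto
    moreover have "f a < 0" using True insert.prems by simp
    ultimately show ?thesis
      using insert.hyps mult_neg_pos[OF \<open>f a < 0\<close> IH] by (simp add: mult_ac)
  next
    case False
    then have "{s\<in>insert a S. x < s} = {s\<in>S. x < s}" by auto
    moreover have "f a > 0" using False insert.prems by simp
    ultimately show ?thesis
      using insert.hyps mult_pos_pos[OF \<open>f a > 0\<close> IH] by (simp add: mult_ac)
  qed
qed simp

section \<open>From cyclic intervals to jumps and parities\<close>

lemma cyc_succ_funpow_mem: "N > 0 \<Longrightarrow> x \<in> {1..N} \<Longrightarrow> (cyc_succ N ^^ i) x \<in> {1..N}"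
  by (induction i) (auto simp: cyc_succ_def Suc_le_eq)

lemma cyc_succ_eq_imp_pred:
  assumes "y \<in> {1..N}" "cyc_succ N y = x" "2 \<le> x"
  shows "y = x - 1"
  using assms by (cases "y = N") (auto simp: cyc_succ_def)

lemma cyc_succ_surj: "j \<in> {1..n} \<Longrightarrow> \<exists>i\<in>{1..n}. cyc_succ n i = j"
  by (rule bexI[of _ "if j = 1 then n else j - 1"]) (auto simp: cyc_succ_def)

text \<open>The set of interval starts works: disjointness makes the starts distinct, and adjacent
  intervals differ in value. The jump criterion is stated from 2 on, where the cyclic predecessor is
  \<open>x - 1\<close>; a start at 1 still counts towards the cardinality.\<close>

lemma consists_of_intervals_jump_set:
  assumes N: "N > 0" and u: "consists_of_intervals N n u"
  obtains S where "S \<subseteq> {1..N}" "card S = n"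
    "\<And>x. x \<in> {2..N} \<Longrightarrow> x \<in> S \<longleftrightarrow> u x \<noteq> u (x - 1)"
proof -
  from u obtain I \<xi> where part: "cyc_interval_partition N n I"
    and alt: "\<And>j. j \<in> {1..n} \<Longrightarrow> \<xi> j \<noteq> \<xi> (cyc_succ n j)"
    and u_eq: "\<And>x. x \<in> {1..N} \<Longrightarrow> u x = (\<Sum>j = 1..n. \<xi> j * indicator (I j) x)"
    unfolding consists_of_intervals_def by blast
  from part obtain s l where disj: "disjoint_family_on I {1..n}"
    and cover: "(\<Union>j\<in>{1..n}. I j) = {1..N}"
    and s: "\<And>j. j \<in> {1..n} \<Longrightarrow> s j \<in> {1..N}" and l: "\<And>j. j \<in> {1..n} \<Longrightarrow> l j \<in> {1..N}"
    and I: "\<And>j. j \<in> {1..n} \<Longrightarrow> I j = cyc_interval N (s j) (l j)"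
    and next_s: "\<And>j. j \<in> {1..n} \<Longrightarrow> s (cyc_succ n j) = (cyc_succ N ^^ l j) (s j)"
    unfolding cyc_interval_partition_def by blast
  have mem_I: "(cyc_succ N ^^ i) (s j) \<in> I j" if "j \<in> {1..n}" "i < l j" for i j
    using that by (auto simp: I cyc_interval_def)
  have s_in: "s j \<in> I j" if "j \<in> {1..n}" for j
    using mem_I[OF that, of 0] l[OF that] by simp
  have same: "i = j" if "x \<in> I i" "x \<in> I j" "i \<in> {1..n}" "j \<in> {1..n}" for i j x
    using disj that unfolding disjoint_family_on_def by blast
  have u_val: "u x = \<xi> j" if j: "j \<in> {1..n}" and x: "x \<in> I j" for x j
  proof -
    have "x \<in> {1..N}" using cover j x by blast
    then have "u x = (\<Sum>i = 1..n. \<xi> i * indicator (I i) x)" by (rule u_eq)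
    also have "\<dots> = (\<Sum>i = 1..n. if i = j then \<xi> i else 0)"
    proof (rule sum.cong)
      fix i assume i: "i \<in> {1..n}"
      show "\<xi> i * indicator (I i) x = (if i = j then \<xi> i else 0)"
        using same[OF _ x i j] x by (cases "i = j") (auto simp: indicator_def)
    qed simp
    also have "\<dots> = \<xi> j" using j by simp
    finally show ?thesis .
  qed
  show thesis
  proof
    show "s ` {1..n} \<subseteq> {1..N}" using s by blast
    have "inj_on s {1..n}" by (rule inj_onI) (metis s_in same)
    then show "card (s ` {1..n}) = n" by (simp add: card_image)
    fix x assume x: "x \<in> {2..N}"
    show "x \<in> s ` {1..n} \<longleftrightarrow> u x \<noteq> u (x - 1)"
    proof
      assume "x \<in> s ` {1..n}"
      then obtain j where j: "j \<in> {1..n}" "x = s j" by blast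
      obtain i where i: "i \<in> {1..n}" "cyc_succ n i = j" using cyc_succ_surj[OF j(1)] by blast
      \<comment> \<open>\<open>y\<close> is the last point of the interval preceding
        \<open>I j\<close>. Its successor is \<open>x\<close>, and 2 \<le> x rules out a
        wrap-around.\<close>
      define y where "y = (cyc_succ N ^^ (l i - 1)) (s i)"
      have li: "l i = Suc (l i - 1)" using l[OF i(1)] by simp
      have "cyc_succ N y = (cyc_succ N ^^ Suc (l i - 1)) (s i)" by (simp add: y_def)
      also have "\<dots> = x" using next_s[OF i(1)] li i(2) j(2) by simp
      finally have "cyc_succ N y = x" .
      moreover have "y \<in> {1..N}" unfolding y_def by (rule cyc_succ_funpow_mem[OF N s[OF i(1)]])
      ultimately have "y = x - 1" using cyc_succ_eq_imp_pred x by simp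
      moreover have "y \<in> I i" unfolding y_def using li by (intro mem_I i) simp
      ultimately have "u (x - 1) = \<xi> i" using u_val[OF i(1)] by simp
      moreover have "u x = \<xi> j" using u_val[OF j(1)] s_in[OF j(1)] j(2) by simp
      ultimately show "u x \<noteq> u (x - 1)" using alt[OF i(1)] i(2) by simp
    next
      assume neq: "u x \<noteq> u (x - 1)"
      have "x \<in> {1..N}" using x by auto
      then obtain j where j: "j \<in> {1..n}" "x \<in> I j" using cover by blast
      then obtain i where i: "i < l j" "x = (cyc_succ N ^^ i) (s j)"
        by (auto simp: I cyc_interval_def)
      show "x \<in> s ` {1..n}"
      proof (cases i)
        case 0
        then show ?thesis using i j by simp
      next
        \<comment> \<open>A point that is not the start of its interval has its predecessor in the
          same interval, so there is no jump.\<close>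
        case (Suc i')
        define y where "y = (cyc_succ N ^^ i') (s j)"
        have "cyc_succ N y = x" by (simp add: y_def i Suc)
        moreover have "y \<in> {1..N}" unfolding y_def by (rule cyc_succ_funpow_mem[OF N s[OF j(1)]])
        ultimately have "y = x - 1" using cyc_succ_eq_imp_pred x by simp
        moreover have "y \<in> I j" unfolding y_def using i Suc by (intro mem_I j) simp
        ultimately have "u (x - 1) = u x" using u_val[OF j(1)] j(2) by simp
        then show ?thesis using neq by simp
      qed
    qed
  qed
qed

text \<open>Moving one step to the right, both sides change sign exactly when the new point is in
  \<open>S\<close>. This identity is all that the two halves of the theorem need to know about the
  position of the jumps.\<close>

lemma binary_sign_eq_jump_parity:
  fixes u :: "nat \<Rightarrow> real"
  assumes bin: "\<And>x. x \<in> {1..N} \<Longrightarrow> u x \<in> {0, 1}" and S: "finite S"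
    and jump: "\<And>x. x \<in> {2..N} \<Longrightarrow> x \<in> S \<longleftrightarrow> u x \<noteq> u (x - 1)"
  obtains \<sigma> :: real where "\<sigma> \<noteq> 0" "\<And>x. x \<in> {1..N} \<Longrightarrow> 1 - 2 * u x = \<sigma> * (-1) ^ card {s\<in>S. x < s}"
proof
  \<comment> \<open>The witness is read off from the identity at x = 1; for N = 0 any nonzero value
    will do.\<close>
  show "(if N = 0 then 1 else (1 - 2 * u 1) * (-1) ^ card {s\<in>S. 1 < s}) \<noteq> (0::real)"
    using bin[of 1] by auto
  show "1 - 2 * u x = (if N = 0 then 1 else (1 - 2 * u 1) * (-1) ^ card {s\<in>S. 1 < s}) *
      (-1) ^ card {s\<in>S. x < s}" if "x \<in> {1..N}" for x
  proof -
    have "1 \<le> x" "x \<le> N" using that by auto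
    then show ?thesis
    proof (induction x rule: dec_induct)
      case base
      then show ?case by (simp flip: power_add mult_2)
    next
      case (step x)
      have N: "N \<noteq> 0" using step by simp
      have bins: "u x \<in> {0, 1}" "u (Suc x) \<in> {0, 1}" using bin step by auto
      have IH: "1 - 2 * u x = (1 - 2 * u 1) * (-1) ^ card {s\<in>S. 1 < s} * (-1) ^ card {s\<in>S. x < s}"
        using step N by simp
      show ?case
      proof (cases "Suc x \<in> S")
        case True
        then have "{s\<in>S. x < s} = insert (Suc x) {s\<in>S. Suc x < s}" by auto
        then have "card {s\<in>S. x < s} = Suc (card {s\<in>S. Suc x < s})" using S by simp
        moreover have "1 - 2 * u (Suc x) = - (1 - 2 * u x)"
          using True jump[of "Suc x"] step bins by auto
        ultimately show ?thesis using IH N by simp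
      next
        case False
        then have "s \<in> S \<Longrightarrow> x < s \<longleftrightarrow> Suc x < s" for s by (metis Suc_lessI Suc_lessD)
        then have "{s\<in>S. x < s} = {s\<in>S. Suc x < s}" by auto
        moreover have "u (Suc x) = u x"
          using False jump[of "Suc x"] step by auto
        ultimately show ?thesis using IH N by simp
      qed
    qed
  qed
qed

section \<open>Fourier coefficients and sines on the grid\<close>

lemma fourier_coeff_eq_sum_cis:
  "fourier_coeff N u k = (\<Sum>x = 1..N. of_real (u x) * cis (-2 * of_int k * (pi * real x / real N)))"
  unfolding fourier_coeff_def cis_conv_exp by (simp add: mult_ac)

lemma fourier_coeff_diff:
  "fourier_coeff N (\<lambda>x. u x - v x) k = fourier_coeff N u k - fourier_coeff N v k"
  by (simp add: fourier_coeff_def algebra_simps sum_subtractf)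

lemma fourier_coeff_add_scaled:
  "fourier_coeff N (\<lambda>x. u x + c * v x) k = fourier_coeff N u k + of_real c * fourier_coeff N v k"
  by (simp add: fourier_coeff_def algebra_simps sum.distrib sum_distrib_left)

lemma fourier_coeff_cong:
  "(\<And>x. x \<in> {1..N} \<Longrightarrow> u x = v x) \<Longrightarrow> fourier_coeff N u k = fourier_coeff N v k"
  unfolding fourier_coeff_def by (intro sum.cong) auto

text \<open>The angles differ by less than pi, where the sine has the sign of its argument.\<close>

lemma sin_grid_sign:
  fixes a b :: real
  assumes "0 < N" "\<bar>a - b\<bar> < N"
  shows "a < b \<Longrightarrow> sin (pi * a / N - pi * b / N) < 0"
    and "b < a \<Longrightarrow> 0 < sin (pi * a / N - pi * b / N)"
proof -
  have pos: "0 < sin (pi * a / N - pi * b / N)" if "b < a" "\<bar>a - b\<bar> < N" for a b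
  proof (rule sin_gt_zero)
    have *: "pi * a / N - pi * b / N = pi * ((a - b) / N)"
      by (simp add: right_diff_distrib diff_divide_distrib)
    show "0 < pi * a / N - pi * b / N" unfolding * using that assms(1) by simp
    have "(a - b) / N < 1" using that assms(1) by simp
    then have "pi * ((a - b) / N) < pi * 1" by (rule mult_strict_left_mono) simp
    then show "pi * a / N - pi * b / N < pi" unfolding * by simp
  qed
  show "b < a \<Longrightarrow> 0 < sin (pi * a / N - pi * b / N)" using pos assms by blast
  show "sin (pi * a / N - pi * b / N) < 0" if "a < b"
  proof -
    have "0 < sin (pi * b / N - pi * a / N)" using that assms by (intro pos) auto
    also have "\<dots> = - sin (pi * a / N - pi * b / N)" by (simp flip: sin_minus)
    finally show ?thesis by simp
  qed
qed

section \<open>Uniqueness and optimality for a given jump set\<close>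

lemma feasible_eq_of_jump_set:
  assumes N: "N > 0" and S: "S \<subseteq> {1..N}" "card S = 2 * d"
    and bin: "\<And>x. x \<in> {1..N} \<Longrightarrow> v x \<in> {0, 1}"
    and \<sigma>: "\<sigma> \<noteq> 0" "\<And>x. x \<in> {1..N} \<Longrightarrow> 1 - 2 * v x = \<sigma> * (-1) ^ card {s\<in>S. x < s}"
    and u: "u \<in> feasible N d v" and x: "x \<in> {1..N}"
  shows "u x = v x"
proof -
  have fin: "finite S" using S finite_subset by blast
  \<comment> \<open>The shift by 1/2 keeps the zeros off the grid.\<close>
  define p where "p x = (\<Prod>s\<in>S. sin (pi * real x / N - pi * (real s - 1/2) / N))" for x
  define h where "h x = u x - v x" for x
  have u01: "0 \<le> u x \<and> u x \<le> 1" if "x \<in> {1..N}" for x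
    using u that by (simp add: feasible_def)
  \<comment> \<open>The factors negative at \<open>x\<close> are those of the jumps after
    \<open>x\<close>, so \<open>p\<close> has the parity sign that \<sigma> relates to
    \<open>1 - 2 * v x\<close>. The half-step shift still leaves differences of at most N -
    1/2.\<close>
  have sgn_p: "0 < (-1) ^ card {s\<in>S. x < s} * p x" if x: "x \<in> {1..N}" for x
    unfolding p_def
  proof (rule sign_prod_threshold[OF fin])
    fix s assume s: "s \<in> S"
    have bound: "\<bar>real x - (real s - 1/2)\<bar> < real N"
    proof -
      have "1 \<le> real s" "real s \<le> N" "1 \<le> real x" "real x \<le> N" using s S x by auto
      then show ?thesis by linarith
    qed
    show "sin (pi * real x / N - pi * (real s - 1/2) / N) < 0" if "x < s"
      by (rule sin_grid_sign(1)[OF _ bound]) (use N that in auto)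
    show "0 < sin (pi * real x / N - pi * (real s - 1/2) / N)" if "\<not> x < s"
      by (rule sin_grid_sign(2)[OF _ bound]) (use N that in auto)
  qed
  have "(\<Sum>x = 1..N. h x * p x) = 0"
    unfolding p_def
  proof (rule sum_times_sin_prod_eq_0[OF fin S(2)])
    fix k :: int assume "\<bar>k\<bar> \<le> int d"
    then have "fourier_coeff N h k = 0"
      using u unfolding h_def fourier_coeff_diff by (simp add: feasible_def)
    then show "(\<Sum>x = 1..N. complex_of_real (h x) * cis (-2 * of_int k * (pi * real x / N))) = 0"
      by (simp only: fourier_coeff_eq_sum_cis)
  qed
  then have "(\<Sum>x = 1..N. \<sigma> * (h x * p x)) = 0"
    by (simp flip: sum_distrib_left)
  \<comment> \<open>Since \<open>v x\<close> is an end of the interval [0,1] containing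
    \<open>u x\<close>, the difference \<open>h x\<close> is zero or has the sign of
    \<open>1 - 2 * v x\<close>. Hence every term of the vanishing sum is nonnegative.\<close>
  moreover have eq: "\<sigma> * (h x * p x) = \<bar>h x\<bar> * (\<bar>\<sigma>\<bar> * \<bar>p x\<bar>)" if x: "x \<in> {1..N}" for x
  proof -
    have "\<bar>1 - 2 * v x\<bar> = 1" using bin[OF x] by auto
    then have abs: "\<bar>\<sigma>\<bar> = 1" using \<sigma>(2)[OF x] by (simp add: abs_mult)
    have "\<sigma> * p x = (1 - 2 * v x) * ((-1) ^ card {s\<in>S. x < s} * p x)"
      unfolding \<sigma>(2)[OF x] by (simp flip: power_add mult_2)
    moreover have "(-1) ^ card {s\<in>S. x < s} * p x = \<bar>p x\<bar>"
    proof -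
      have "(-1) ^ card {s\<in>S. x < s} * p x = \<bar>(-1) ^ card {s\<in>S. x < s} * p x\<bar>"
        using sgn_p[OF x] by simp
      then show ?thesis by (simp add: abs_mult power_abs)
    qed
    moreover have "h x * (1 - 2 * v x) = \<bar>h x\<bar>"
      using bin[OF x] u01[OF x] by (auto simp: h_def)
    ultimately have "h x * (\<sigma> * p x) = \<bar>h x\<bar> * \<bar>p x\<bar>"
      by (simp only: mult.assoc[symmetric])
    then show ?thesis using abs by (simp add: mult_ac)
  qed
  ultimately have "(\<Sum>x = 1..N. \<bar>h x\<bar> * (\<bar>\<sigma>\<bar> * \<bar>p x\<bar>)) = 0"
    by simp
  then have "\<bar>h x\<bar> * (\<bar>\<sigma>\<bar> * \<bar>p x\<bar>) = 0"
    using x by (subst (asm) sum_nonneg_eq_0_iff) auto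
  moreover have "p x \<noteq> 0" using sgn_p[OF x] by auto
  ultimately show ?thesis using \<sigma>(1) by (simp add: h_def)
qed

lemma feasible_other_of_jump_set:
  assumes N: "N > 0" and S: "S \<subseteq> {1..N}" "card S = 2 * d" and m: "m < d"
    and v: "v \<in> {1..N} \<rightarrow>\<^sub>E {0, 1}"
    and \<sigma>: "\<sigma> \<noteq> 0" "\<And>x. x \<in> {1..N} \<Longrightarrow> 1 - 2 * v x = \<sigma> * (-1) ^ card {s\<in>S. x < s}"
  obtains u where "u \<in> feasible N m v" "u \<noteq> v"
proof -
  have fin: "finite S" using S finite_subset by blast
  have bin: "v x \<in> {0, 1}" if "x \<in> {1..N}" for x using v that by auto
  define q where "q s = (\<Prod>t\<in>S-{s}. sin (pi * real s / N - pi * real t / N))" for s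
  \<comment> \<open>These are the divided difference weights, placed at the jumps and extended by
    zero.\<close>
  define h where "h s = (if s \<in> S then 1 / q s else 0)" for s
  \<comment> \<open>The sign of \<sigma> directs the perturbation into [0,1]; the denominator bounds
    its size by 1, and the summand 1 keeps that denominator positive.\<close>
  define c where "c = \<sigma> / (\<bar>\<sigma>\<bar> * (1 + (\<Sum>s\<in>S. \<bar>h s\<bar>)))"
  define u where "u x = v x + c * h x" for x
  have sin_sign: "s < t \<Longrightarrow> sin (pi * real s / N - pi * real t / N) < 0"
    "t < s \<Longrightarrow> 0 < sin (pi * real s / N - pi * real t / N)" if "s \<in> S" "t \<in> S" for s t
  proof -
    have "1 \<le> real s" "real s \<le> N" "1 \<le> real t" "real t \<le> N" using that S by auto
    then have bound: "\<bar>real s - real t\<bar> < real N" by linarith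
    show "s < t \<Longrightarrow> sin (pi * real s / N - pi * real t / N) < 0"
      by (rule sin_grid_sign(1)[OF _ bound]) (use N in auto)
    show "t < s \<Longrightarrow> 0 < sin (pi * real s / N - pi * real t / N)"
      by (rule sin_grid_sign(2)[OF _ bound]) (use N in auto)
  qed
  have sgn_q: "0 < (-1) ^ card {t\<in>S. s < t} * q s" if s: "s \<in> S" for s
  proof -
    \<comment> \<open>Removing \<open>s\<close> leaves the count unchanged, as the comparison
      \<open>s < t\<close> is strict.\<close>
    have "0 < (-1) ^ card {t\<in>S-{s}. s < t} * q s"
      unfolding q_def
    proof (rule sign_prod_threshold)
      fix t assume t: "t \<in> S - {s}"
      then show "s < t \<Longrightarrow> sin (pi * real s / N - pi * real t / N) < 0"
        using sin_sign(1) s by auto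
      show "0 < sin (pi * real s / N - pi * real t / N)" if "\<not> s < t"
        using sin_sign(2)[of s t] s t that by auto
    qed (use fin in simp)
    also have "{t\<in>S-{s}. s < t} = {t\<in>S. s < t}" by auto
    finally show ?thesis .
  qed
  have h_pos: "0 < (-1) ^ card {t\<in>S. s < t} * h s" if s: "s \<in> S" for s
    using sgn_q[OF s] s by (cases "even (card {t\<in>S. s < t})") (auto simp: h_def)
  have h_nz: "h s \<noteq> 0" if "s \<in> S" for s using h_pos[OF that] by auto
  have h_fourier: "fourier_coeff N h k = 0" if k: "\<bar>k\<bar> < int d" for k
  proof -
    have "fourier_coeff N h k = (\<Sum>s\<in>S. of_real (h s) * cis (-2 * of_int k * (pi * real s / real N)))"
      unfolding fourier_coeff_eq_sum_cis
      by (rule sum.mono_neutral_right) (use S in \<open>auto simp: h_def\<close>)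
    also have "\<dots> = (\<Sum>s\<in>S. of_real (1 / q s) * cis (-2 * of_int k * (pi * real s / real N)))"
      by (rule sum.cong) (auto simp: h_def)
    also have "\<dots> = 0"
      unfolding q_def
    proof (rule sum_cis_div_sin_prod_eq_0[OF fin S(2) _ k])
      show "sin (pi * real s / N - pi * real t / N) \<noteq> 0" if "s \<in> S" "t \<in> S" "s \<noteq> t" for s t
        using sin_sign[OF that(1,2)] that(3) by (cases "s < t") auto
    qed
    finally show ?thesis .
  qed
  define M where "M = 1 + (\<Sum>s\<in>S. \<bar>h s\<bar>)"
  have M: "M > 0" by (simp add: M_def add_pos_nonneg sum_nonneg)
  have c_nz: "c \<noteq> 0" using \<sigma>(1) M by (simp add: c_def M_def)
  \<comment> \<open>The perturbation is nonnegative where \<open>v\<close> is 0 and nonpositive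
    where \<open>v\<close> is 1. With modulus at most 1 it therefore stays within [0,1].\<close>
  have bounds: "0 \<le> (1 - 2 * v x) * (c * h x) \<and> \<bar>c * h x\<bar> \<le> 1" if x: "x \<in> {1..N}" for x
  proof (cases "x \<in> S")
    case True
    have "\<bar>h x\<bar> \<le> (\<Sum>s\<in>S. \<bar>h s\<bar>)"
      by (rule member_le_sum) (use True fin in auto)
    then have "\<bar>h x\<bar> \<le> M" by (simp add: M_def)
    moreover have "\<bar>c * h x\<bar> = \<bar>h x\<bar> / M"
      using \<sigma>(1) M by (simp add: c_def abs_mult flip: M_def)
    ultimately have "\<bar>c * h x\<bar> \<le> 1" using M by simp
    moreover have "(1 - 2 * v x) * (c * h x) =
        (\<sigma> * \<sigma> / (\<bar>\<sigma>\<bar> * M)) * ((-1) ^ card {t\<in>S. x < t} * h x)"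
      unfolding \<sigma>(2)[OF x] by (simp add: c_def flip: M_def)
    moreover have "0 \<le> \<dots>" using h_pos[OF True] M
      by (intro mult_nonneg_nonneg[OF _ less_imp_le]) auto
    ultimately show ?thesis by simp
  qed (simp add: h_def)
  show thesis
  proof
    \<comment> \<open>Outside the grid \<open>h\<close> is zero because S lies in
      \<open>{1..N}\<close>, so \<open>u\<close> inherits the value \<open>undefined\<close> from
      \<open>v\<close>.\<close>
    have "u \<in> {1..N} \<rightarrow>\<^sub>E UNIV"
      using v S by (auto simp: u_def h_def PiE_def extensional_def)
    moreover have "fourier_coeff N u k = fourier_coeff N v k" if "\<bar>k\<bar> \<le> int m" for k
      using h_fourier[of k] m that unfolding u_def fourier_coeff_add_scaled by simp
    moreover have "0 \<le> u x \<and> u x \<le> 1" if x: "x \<in> {1..N}" for x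
      using bounds[OF x] bin[OF x] by (auto simp: u_def)
    ultimately show "u \<in> feasible N m v" by (simp add: feasible_def)
    have "S \<noteq> {}" using S(2) m by auto
    then obtain s where "s \<in> S" by blast
    then have "u s \<noteq> v s" using c_nz h_nz by (simp add: u_def)
    then show "u \<noteq> v" by auto
  qed
qed

theorem mainTheorem1:
  fixes N d :: nat and u\<^sub>0 :: "nat \<Rightarrow> real"
  assumes "even N" and "N > 0" and "d \<ge> 1"
    and "u\<^sub>0 \<in> {1..N} \<rightarrow>\<^sub>E {0, 1}"
    and "consists_of_intervals N (2 * d) u\<^sub>0"
  shows "feasible N d u\<^sub>0 = {u\<^sub>0} \<and> (\<forall>m<d. feasible N m u\<^sub>0 \<noteq> {u\<^sub>0})"
proof -
  have bin: "u\<^sub>0 x \<in> {0, 1}" if "x \<in> {1..N}" for x using assms(4) that by auto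
  obtain S where S: "S \<subseteq> {1..N}" "card S = 2 * d"
    and jump: "\<And>x. x \<in> {2..N} \<Longrightarrow> x \<in> S \<longleftrightarrow> u\<^sub>0 x \<noteq> u\<^sub>0 (x - 1)"
    using consists_of_intervals_jump_set[OF assms(2,5)] by metis
  have "finite S" using S finite_subset by blast
  then obtain \<sigma> :: real where \<sigma>: "\<sigma> \<noteq> 0"
    "\<And>x. x \<in> {1..N} \<Longrightarrow> 1 - 2 * u\<^sub>0 x = \<sigma> * (-1) ^ card {s\<in>S. x < s}"
    using binary_sign_eq_jump_parity[OF bin _ jump] by metis
  have "u\<^sub>0 \<in> feasible N d u\<^sub>0"
    using assms(4) bin by (fastforce simp: feasible_def PiE_def)
  moreover have "u = u\<^sub>0" if u: "u \<in> feasible N d u\<^sub>0" for u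
  \<comment> \<open>Both signals are \<open>undefined\<close> off the grid, so agreement on
    \<open>{1..N}\<close> gives equality of functions.\<close>
  proof (rule extensionalityI)
    show "u \<in> extensional {1..N}" using u by (auto simp: feasible_def PiE_def)
    show "u\<^sub>0 \<in> extensional {1..N}" using assms(4) by (auto simp: PiE_def)
    show "u x = u\<^sub>0 x" if "x \<in> {1..N}" for x
      by (rule feasible_eq_of_jump_set[OF assms(2) S bin \<sigma> u that])
  qed
  moreover have "feasible N m u\<^sub>0 \<noteq> {u\<^sub>0}" if "m < d" for m
    using feasible_other_of_jump_set[OF assms(2) S that assms(4) \<sigma>] by (metis singletonD)
  ultimately show ?thesis by blast
qed

end
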